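(* Let $G$ be a finitely generated group acting by isometries on a quasitree $Q$. Then for any $x_0\in Q$ there is $r>0$ such that the Rips orbit graph $\Gamma_r(x_0)$ is connected and, when it is equipped with its own path metric, there is a coarse $G$-equivariant quasi-isometric embedding from $\Gamma_r(x_0)$ to $Q$. If moreover $G\cdot x_0$ is a locally finite orbit then $\Gamma_r(x_0)$ has bounded valence.
   Context: A quasitree is a geodesic metric space that is quasi-isometric to a simplicial tree. For $G$ acting by isometries on a metric space $(X,d_X)$, $x_0\in X$ and $r\ge 0$, the Rips orbit graph $\Gamma_r(x_0)$ is the graph with vertex set the orbit $G\cdot x_0$ and an edge between distinct vertices $v,w$ if and only if $d_X(v,w)\le r$; $G$ acts on it by graph automorphisms, vertex transitively. The orbit $G\cdot x_0$ is locally finite if for all $R\ge 0$ the set of points $\{g(x_0): g\in G,\ d_X(g(x_0),x_0)\le R\}$ is finite. If $G$ acts by isometries on metric spaces $Y$ and $X$, a map $F:Y\to X$ is coarse $G$-equivariant if there is $M\ge 0$ with $d_X(F(g(y)),g(F(y)))\le M$ for all $y\in Y$, $g\in G$. *)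

theory Defs
  imports
    "HOL-Analysis.Abstract_Metric_Spaces"
    "HOL-Algebra.Group_Action"
    "HOL-Algebra.Generated_Groups"
begin

section \<open>Metric notions\<close>

definition geodesic_space :: "'a set \<Rightarrow> ('a \<Rightarrow> 'a \<Rightarrow> real) \<Rightarrow> bool" where
  "geodesic_space X d \<longleftrightarrow>
     Metric_space X d \<and>
     (\<forall>x\<in>X. \<forall>y\<in>X. \<exists>\<gamma> :: real \<Rightarrow> 'a.
        \<gamma> ` {0..d x y} \<subseteq> X \<and> \<gamma> 0 = x \<and> \<gamma> (d x y) = y \<and>
        (\<forall>s\<in>{0..d x y}. \<forall>t\<in>{0..d x y}. d (\<gamma> s) (\<gamma> t) = \<bar>s - t\<bar>))"

definition qi_embedding ::
  "'a set \<Rightarrow> ('a \<Rightarrow> 'a \<Rightarrow> real) \<Rightarrow> 'b set \<Rightarrow> ('b \<Rightarrow> 'b \<Rightarrow> real) \<Rightarrow> ('a \<Rightarrow> 'b) \<Rightarrow> bool" where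
  "qi_embedding X dX Y dY f \<longleftrightarrow>
     f ` X \<subseteq> Y \<and>
     (\<exists>K\<ge>1. \<exists>C\<ge>0. \<forall>x\<in>X. \<forall>x'\<in>X.
        dX x x' / K - C \<le> dY (f x) (f x') \<and> dY (f x) (f x') \<le> K * dX x x' + C)"

definition quasi_isometry ::
  "'a set \<Rightarrow> ('a \<Rightarrow> 'a \<Rightarrow> real) \<Rightarrow> 'b set \<Rightarrow> ('b \<Rightarrow> 'b \<Rightarrow> real) \<Rightarrow> ('a \<Rightarrow> 'b) \<Rightarrow> bool" where
  "quasi_isometry X dX Y dY f \<longleftrightarrow>
     qi_embedding X dX Y dY f \<and> (\<exists>C\<ge>0. \<forall>y\<in>Y. \<exists>x\<in>X. dY (f x) y \<le> C)"


section \<open>Graphs and their path metrics\<close>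

definition simplicial_graph :: "'v set \<Rightarrow> ('v \<times> 'v) set \<Rightarrow> bool" where
  "simplicial_graph V E \<longleftrightarrow> E \<subseteq> V \<times> V \<and> sym E \<and> irrefl E"

definition connected_graph :: "'v set \<Rightarrow> ('v \<times> 'v) set \<Rightarrow> bool" where
  "connected_graph V E \<longleftrightarrow> (\<forall>v\<in>V. \<forall>w\<in>V. (v, w) \<in> E\<^sup>*)"

definition bounded_valence :: "'v set \<Rightarrow> ('v \<times> 'v) set \<Rightarrow> bool" where
  "bounded_valence V E \<longleftrightarrow>
     (\<exists>N::nat. \<forall>v\<in>V. finite {w. (v, w) \<in> E} \<and> card {w. (v, w) \<in> E} \<le> N)"

definition graph_cycle :: "('v \<times> 'v) set \<Rightarrow> 'v list \<Rightarrow> bool" where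
  "graph_cycle E vs \<longleftrightarrow>
     3 \<le> length vs \<and> distinct vs \<and>
     successively (\<lambda>v w. (v, w) \<in> E) vs \<and> (last vs, hd vs) \<in> E"

definition simplicial_tree :: "'v set \<Rightarrow> ('v \<times> 'v) set \<Rightarrow> bool" where
  "simplicial_tree V E \<longleftrightarrow>
     simplicial_graph V E \<and> V \<noteq> {} \<and> connected_graph V E \<and> \<not> (\<exists>vs. graph_cycle E vs)"

text \<open>
  As a metric space, a graph is its geometric realization with all edges of length one. A point
  is given by its barycentric coordinates. The cell of an edge \<open>(a, b)\<close> is the closed unit
  interval, parametrized by the coordinate at \<open>a\<close>, and the cell of \<open>(a, a)\<close> is the vertex \<open>a\<close>.
\<close>

definition cell :: "'v \<Rightarrow> 'v \<Rightarrow> ('v \<Rightarrow> real) set" where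
  "cell a b = {p. (\<forall>v. 0 \<le> p v) \<and> (\<forall>v. v \<notin> {a, b} \<longrightarrow> p v = 0) \<and> (\<Sum>v\<in>{a, b}. p v) = 1}"

definition realization :: "'v set \<Rightarrow> ('v \<times> 'v) set \<Rightarrow> ('v \<Rightarrow> real) set" where
  "realization V E = (\<Union>a\<in>V. cell a a) \<union> (\<Union>(a, b)\<in>E. cell a b)"

text \<open>
  \<open>pl_path E p q l\<close>: some piecewise linear path of length \<open>l\<close>, each piece of which is a segment
  of a closed edge, joins \<open>p\<close> to \<open>q\<close>.
\<close>

inductive pl_path :: "('v \<times> 'v) set \<Rightarrow> ('v \<Rightarrow> real) \<Rightarrow> ('v \<Rightarrow> real) \<Rightarrow> real \<Rightarrow> bool" for E where
  trivial: "pl_path E p p 0"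
| segment: "pl_path E p r (\<bar>p a - q a\<bar> + l)"
    if "(a, b) \<in> E" "p \<in> cell a b" "q \<in> cell a b" "pl_path E q r l"

definition path_metric :: "('v \<times> 'v) set \<Rightarrow> ('v \<Rightarrow> real) \<Rightarrow> ('v \<Rightarrow> real) \<Rightarrow> real" where
  "path_metric E p q = Inf {l. pl_path E p q l}"

text \<open>The map of realizations induced by a map of vertices, affine on each edge.\<close>

definition simplicial_map :: "('v \<Rightarrow> 'w) \<Rightarrow> ('v \<Rightarrow> real) \<Rightarrow> 'w \<Rightarrow> real" where
  "simplicial_map f p = (\<lambda>w. \<Sum>v | p v \<noteq> 0 \<and> f v = w. p v)"


section \<open>Quasitrees\<close>

text \<open>
  HOL cannot quantify existentially over types, so the type \<open>'v\<close> that the vertices of the tree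
  are taken from is a parameter. In a hypothesis, leaving it free amounts to allowing trees
  over any type.
\<close>

definition quasitree :: "'v itself \<Rightarrow> 'q set \<Rightarrow> ('q \<Rightarrow> 'q \<Rightarrow> real) \<Rightarrow> bool" where
  "quasitree (_ :: 'v itself) Q d \<longleftrightarrow>
     geodesic_space Q d \<and>
     (\<exists>(V :: 'v set) E f. simplicial_tree V E \<and>
        quasi_isometry Q d (realization V E) (path_metric E) f)"


section \<open>Groups acting by isometries\<close>

definition finitely_generated :: "('g, 'm) monoid_scheme \<Rightarrow> bool" where
  "finitely_generated G \<longleftrightarrow> (\<exists>S. finite S \<and> S \<subseteq> carrier G \<and> generate G S = carrier G)"

definition isometric_action ::
  "('g, 'm) monoid_scheme \<Rightarrow> 'q set \<Rightarrow> ('q \<Rightarrow> 'q \<Rightarrow> real) \<Rightarrow> ('g \<Rightarrow> 'q \<Rightarrow> 'q) \<Rightarrow> bool" where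
  "isometric_action G Q d \<phi> \<longleftrightarrow>
     group_action G Q \<phi> \<and> Metric_space Q d \<and>
     (\<forall>g\<in>carrier G. \<forall>x\<in>Q. \<forall>y\<in>Q. d (\<phi> g x) (\<phi> g y) = d x y)"

definition rips_edges ::
  "('g, 'm) monoid_scheme \<Rightarrow> ('q \<Rightarrow> 'q \<Rightarrow> real) \<Rightarrow> ('g \<Rightarrow> 'q \<Rightarrow> 'q) \<Rightarrow> real \<Rightarrow> 'q \<Rightarrow> ('q \<times> 'q) set" where
  "rips_edges G d \<phi> r x0 =
     {(v, w). v \<in> orbit G \<phi> x0 \<and> w \<in> orbit G \<phi> x0 \<and> v \<noteq> w \<and> d v w \<le> r}"

definition locally_finite_orbit ::
  "('g, 'm) monoid_scheme \<Rightarrow> ('q \<Rightarrow> 'q \<Rightarrow> real) \<Rightarrow> ('g \<Rightarrow> 'q \<Rightarrow> 'q) \<Rightarrow> 'q \<Rightarrow> bool" where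
  "locally_finite_orbit G d \<phi> x0 \<longleftrightarrow>
     (\<forall>R\<ge>0. finite {\<phi> g x0 | g. g \<in> carrier G \<and> d (\<phi> g x0) x0 \<le> R})"

definition coarse_equivariant ::
  "('g, 'm) monoid_scheme \<Rightarrow> 'y set \<Rightarrow> ('g \<Rightarrow> 'y \<Rightarrow> 'y) \<Rightarrow>
   ('x \<Rightarrow> 'x \<Rightarrow> real) \<Rightarrow> ('g \<Rightarrow> 'x \<Rightarrow> 'x) \<Rightarrow> ('y \<Rightarrow> 'x) \<Rightarrow> bool" where
  "coarse_equivariant G Y \<psi> dX \<phi> F \<longleftrightarrow>
     (\<exists>M\<ge>0. \<forall>y\<in>Y. \<forall>g\<in>carrier G. dX (F (\<psi> g y)) (\<phi> g (F y)) \<le> M)"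

end

theory Submission
  imports Defs
begin

text \<open>
  Since the group is finitely generated, the orbit is coarsely connected: any two of its points
  are joined by a chain in the orbit with steps bounded by some constant \<open>R\<close>. Carry such a chain
  from \<open>x\<close> to \<open>y\<close> to the tree. Every vertex of a tree geodesic separates its endpoints, so the
  image of the chain has to pass within a uniform distance of each vertex of the geodesic.
  Choosing a nearby orbit point for each vertex gives a chain of steps at most some uniform \<open>r\<close>
  whose length is affine in \<open>d x y\<close>. Hence the Rips graph with constant \<open>r\<close> is connected, and
  sending a point of it to an endpoint of its edge is a quasi-isometric embedding.

  Lower bounds for path metrics come from the affine extension of a function of the vertices
  which varies by at most \<open>c\<close> along each edge: it is \<open>c\<close>-Lipschitz along piecewise linear paths,
  so that these never have to be compared with edge paths.
\<close>

section \<open>Path metrics of graphs\<close>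

definition affine_extension :: "('v \<Rightarrow> real) \<Rightarrow> ('v \<Rightarrow> real) \<Rightarrow> real" where
  "affine_extension D p = (\<Sum>v | p v \<noteq> 0. p v * D v)"

lemma cell_commute: "cell a b = cell b a"
  by (simp add: cell_def insert_commute)

lemma cell_bounds:
  assumes "p \<in> cell a b"
  shows "0 \<le> p a" "p a \<le> 1"
proof -
  show "0 \<le> p a" using assms by (simp add: cell_def)
  have "p a \<le> (\<Sum>v\<in>{a, b}. p v)"
    using assms by (intro member_le_sum) (auto simp: cell_def)
  then show "p a \<le> 1" using assms by (simp add: cell_def)
qed

text \<open>On a cell the coordinate at \<open>a\<close> determines the point, the other coordinate
  being \<open>1 - p a\<close>. In the degenerate cell \<open>a = b\<close> this factor is zero, so
  one formula covers vertices as well.\<close>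

lemma affine_extension_cell:
  assumes "p \<in> cell a b"
  shows "affine_extension D p = p a * D a + (1 - p a) * D b"
proof -
  have "affine_extension D p = (\<Sum>v\<in>{a, b}. p v * D v)"
    unfolding affine_extension_def
    using assms by (intro sum.mono_neutral_left) (auto simp: cell_def)
  also have "\<dots> = p a * D a + (1 - p a) * D b"
  proof (cases "a = b")
    case True
    then show ?thesis using assms by (simp add: cell_def)
  next
    case False
    then have "p b = 1 - p a" using assms by (simp add: cell_def)
    then show ?thesis using False by simp
  qed
  finally show ?thesis .
qed

text \<open>Within a cell the extension is affine in the coordinate at \<open>a\<close> with slope
  \<open>D a - D b\<close>, so a segment changes it by at most \<open>c\<close> times the length of
  the segment.\<close>

lemma pl_path_lipschitz:
  assumes "pl_path E p q l" and "\<And>u w. (u, w) \<in> E \<Longrightarrow> \<bar>D u - D w\<bar> \<le> c"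
  shows "\<bar>affine_extension D p - affine_extension D q\<bar> \<le> c * l"
  using assms(1)
proof induction
  case (trivial p)
  then show ?case by simp
next
  case (segment a b p q r l)
  have "affine_extension D p - affine_extension D q = (p a - q a) * (D a - D b)"
    using segment by (simp add: affine_extension_cell algebra_simps)
  then have "\<bar>affine_extension D p - affine_extension D q\<bar> = \<bar>p a - q a\<bar> * \<bar>D a - D b\<bar>"
    by (simp add: abs_mult)
  also have "\<dots> \<le> \<bar>p a - q a\<bar> * c"
    using assms(2) segment by (intro mult_left_mono) auto
  finally show ?case
    using segment.IH by (simp add: algebra_simps)
qed

section \<open>Piecewise linear paths from edge walks, and bounds for the path metric\<close>

lemma pl_path_nonneg: "pl_path E p q l \<Longrightarrow> 0 \<le> l"
  by (induction rule: pl_path.induct) auto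

lemma pl_path_trans: "pl_path E p q l \<Longrightarrow> pl_path E q s m \<Longrightarrow> pl_path E p s (l + m)"
proof (induction rule: pl_path.induct)
  case (trivial p)
  then show ?case by simp
next
  case (segment a b p q r l)
  have "pl_path E p s (\<bar>p a - q a\<bar> + (l + m))"
    using segment by (intro pl_path.segment[of a b]) auto
  then show ?case by (simp add: add.assoc)
qed

lemma pl_path_single:
  assumes "(a, b) \<in> E" "p \<in> cell a b" "q \<in> cell a b"
  shows "\<exists>l\<le>1. pl_path E p q l"
proof -
  have "pl_path E p q (\<bar>p a - q a\<bar> + 0)"
    using assms by (intro pl_path.segment[OF _ _ _ pl_path.trivial]) auto
  moreover have "\<bar>p a - q a\<bar> + 0 \<le> 1"
    using cell_bounds[OF assms(2)] cell_bounds[OF assms(3)] by auto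
  ultimately show ?thesis by blast
qed

lemma path_metric_le: "pl_path E p q l \<Longrightarrow> path_metric E p q \<le> l"
  unfolding path_metric_def
  by (rule cInf_lower) (auto intro!: bdd_belowI[of _ 0] pl_path_nonneg)

lemma vertex_in_cell: "indicator {a} \<in> cell a b"
  by (auto simp: cell_def sum.If_cases indicator_def)

text \<open>The reflexive closure lets a walk pause, as chains in the orbit may repeat points. A
  pause costs no length, hence a bound instead of an equality.\<close>

lemma pl_path_walk:
  "(v, w) \<in> (E\<^sup>=) ^^ n \<Longrightarrow> \<exists>l\<le>real n. pl_path E (indicator {v}) (indicator {w}) l"
proof (induction n arbitrary: w)
  case 0
  then show ?case by (auto intro: pl_path.trivial)
next
  case (Suc n)
  then obtain u where u: "(v, u) \<in> (E\<^sup>=) ^^ n" "(u, w) \<in> E\<^sup>=" by auto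
  from Suc.IH[OF u(1)] obtain l where
    l: "l \<le> real n" "pl_path E (indicator {v}) (indicator {u}) l" by blast
  show ?case
  proof (cases "u = w")
    case True
    then show ?thesis using l by (intro exI[of _ l]) auto
  next
    case False
    then have "(u, w) \<in> E" using u by auto
    then obtain m where "m \<le> 1" "pl_path E (indicator {u}) (indicator {w}) m"
      using pl_path_single[OF _ vertex_in_cell] vertex_in_cell[of w u] cell_commute[of u w]
      by metis
    then show ?thesis using l pl_path_trans by (intro exI[of _ "l + m"]) auto
  qed
qed

text \<open>Cells are indexed by ordered pairs; symmetry of the edges allows any vertex of the
  support to be put first. The case \<open>b = a\<close> covers points that are vertices, isolated
  ones included.\<close>

lemma realization_cell:
  assumes "simplicial_graph V E" "p \<in> realization V E" "p a \<noteq> 0"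
  shows "a \<in> V" "\<exists>b. p \<in> cell a b \<and> (b = a \<or> (a, b) \<in> E)"
proof -
  have E: "E \<subseteq> V \<times> V" "sym E" using assms(1) by (auto simp: simplicial_graph_def)
  have "a \<in> V \<and> (\<exists>b. p \<in> cell a b \<and> (b = a \<or> (a, b) \<in> E))"
  proof (cases "\<exists>c\<in>V. p \<in> cell c c")
    case True
    then obtain c where c: "c \<in> V" "p \<in> cell c c" by blast
    then have "a = c" using assms(3) by (auto simp: cell_def)
    then show ?thesis using c by auto
  next
    case False
    then obtain u w where uw: "(u, w) \<in> E" "p \<in> cell u w"
      using assms(2) by (auto simp: realization_def)
    then have "a = u \<or> a = w" using assms(3) by (auto simp: cell_def)
    then show ?thesis
    proof
      assume "a = u"
      then show ?thesis using uw E by auto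
    next
      assume "a = w"
      then have "(a, u) \<in> E" "p \<in> cell a u" using uw E(2) cell_commute[of u w] by (auto dest: symD)
      then show ?thesis using E(1) by auto
    qed
  qed
  then show "a \<in> V" "\<exists>b. p \<in> cell a b \<and> (b = a \<or> (a, b) \<in> E)" by auto
qed

lemma realization_support: "p \<in> realization V E \<Longrightarrow> \<exists>a. p a \<noteq> 0"
proof -
  assume "p \<in> realization V E"
  then obtain a b where "p \<in> cell a b" by (auto simp: realization_def)
  then have "(\<Sum>v\<in>{a, b}. p v) \<noteq> 0" by (simp add: cell_def)
  then show ?thesis by (meson sum.not_neutral_contains_not_neutral)
qed

lemma pl_path_to_vertex:
  assumes "simplicial_graph V E" "p \<in> realization V E" "p a \<noteq> 0"
  shows "\<exists>l\<le>1. pl_path E p (indicator {a}) l" "\<exists>l\<le>1. pl_path E (indicator {a}) p l"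
proof -
  obtain b where b: "p \<in> cell a b" "b = a \<or> (a, b) \<in> E"
    using realization_cell[OF assms] by blast
  have "(\<exists>l\<le>1. pl_path E p (indicator {a}) l) \<and> (\<exists>l\<le>1. pl_path E (indicator {a}) p l)"
  proof (cases "(a, b) \<in> E")
    case True
    then show ?thesis using b vertex_in_cell[of a b] pl_path_single[OF True] by blast
  next
    case False
    then have "p = indicator {a}" using b by (auto simp: cell_def indicator_def fun_eq_iff)
    then show ?thesis by (auto intro!: exI[of _ 0] pl_path.trivial)
  qed
  then show "\<exists>l\<le>1. pl_path E p (indicator {a}) l" "\<exists>l\<le>1. pl_path E (indicator {a}) p l" by auto
qed

text \<open>Go from \<open>p\<close> to \<open>a\<close>, follow the walk to \<open>b\<close>, then
  go to \<open>q\<close>. The two end pieces lie in single cells and account for the summand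
  2.\<close>

lemma pl_path_realization:
  assumes "simplicial_graph V E" "p \<in> realization V E" "q \<in> realization V E"
    and "p a \<noteq> 0" "q b \<noteq> 0" "(a, b) \<in> (E\<^sup>=) ^^ n"
  shows "\<exists>l\<le>real n + 2. pl_path E p q l"
proof -
  obtain l1 where l1: "l1 \<le> 1" "pl_path E p (indicator {a}) l1"
    using pl_path_to_vertex assms by metis
  obtain l2 where l2: "l2 \<le> real n" "pl_path E (indicator {a}) (indicator {b}) l2"
    using pl_path_walk assms by metis
  obtain l3 where l3: "l3 \<le> 1" "pl_path E (indicator {b}) q l3"
    using pl_path_to_vertex assms by metis
  have "pl_path E p q (l1 + l2 + l3)"
    using l1 l2 l3 pl_path_trans by metis
  then show ?thesis using l1 l2 l3 by (intro exI[of _ "l1 + l2 + l3"]) auto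
qed

lemma path_metric_le_walk:
  assumes "simplicial_graph V E" "p \<in> realization V E" "q \<in> realization V E"
    and "p a \<noteq> 0" "q b \<noteq> 0" "(a, b) \<in> (E\<^sup>=) ^^ n"
  shows "path_metric E p q \<le> real n + 2"
  using pl_path_realization[OF assms] path_metric_le by (metis order_trans)

text \<open>Makes the infimum in \<open>path_metric\<close> one over a nonempty set, so that a lower
  bound for all path lengths passes to it.\<close>

lemma pl_path_exists:
  assumes G: "simplicial_graph V E" "connected_graph V E"
    and p: "p \<in> realization V E" and q: "q \<in> realization V E"
  shows "{l. pl_path E p q l} \<noteq> {}"
proof -
  obtain a b where ab: "p a \<noteq> 0" "q b \<noteq> 0" using realization_support p q by metis
  then have "(a, b) \<in> E\<^sup>*"
    using G realization_cell(1)[OF G(1)] p q by (auto simp: connected_graph_def)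
  then have "(a, b) \<in> (E\<^sup>=)\<^sup>*" by simp
  then obtain n where "(a, b) \<in> (E\<^sup>=) ^^ n" by (metis rtrancl_power)
  then show ?thesis using pl_path_realization[OF G(1) p q ab] by blast
qed

lemma path_metric_nonneg:
  assumes "simplicial_graph V E" "connected_graph V E" "p \<in> realization V E" "q \<in> realization V E"
  shows "0 \<le> path_metric E p q"
  unfolding path_metric_def
  using pl_path_exists[OF assms] by (intro cInf_greatest) (auto intro: pl_path_nonneg)

text \<open>Source of all nontrivial lower bounds for path metrics. It is applied to the distance
  from a vertex in the tree, with \<open>c = 1\<close>, and to the distance \<open>d\<close> from an
  orbit point on the Rips graph, with \<open>c = r\<close>. Moving from \<open>p\<close> to
  \<open>a\<close> and from \<open>q\<close> to \<open>b\<close> changes the extension by at most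
  \<open>c\<close> each, whence the summand 2.\<close>

lemma lipschitz_le_path_metric:
  assumes G: "simplicial_graph V E" "connected_graph V E"
    and p: "p \<in> realization V E" "p a \<noteq> 0" and q: "q \<in> realization V E" "q b \<noteq> 0"
    and lip: "\<And>u w. (u, w) \<in> E \<Longrightarrow> \<bar>D u - D w\<bar> \<le> c" and "0 < c"
  shows "\<bar>D a - D b\<bar> \<le> c * (path_metric E p q + 2)"
proof -
  have near: "\<bar>affine_extension D s - D e\<bar> \<le> c"
    if s: "s \<in> realization V E" "s e \<noteq> 0" for s e
  proof -
    obtain e' where e': "s \<in> cell e e'" "e' = e \<or> (e, e') \<in> E"
      using realization_cell[OF G(1) s] by blast
    have "affine_extension D s - D e = (1 - s e) * (D e' - D e)"
      using affine_extension_cell[OF e'(1)] by (simp add: algebra_simps)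
    moreover have "\<bar>1 - s e\<bar> \<le> 1" using cell_bounds[OF e'(1)] by auto
    moreover have "\<bar>D e' - D e\<bar> \<le> c" using e'(2) lip[of e e'] \<open>0 < c\<close> by auto
    ultimately show ?thesis
      using mult_mono[of "\<bar>1 - s e\<bar>" 1 "\<bar>D e' - D e\<bar>" c] by (simp add: abs_mult)
  qed
  \<comment> \<open>Dividing by \<open>c\<close> isolates the path length, over which the infimum is
    taken.\<close>
  have "(\<bar>D a - D b\<bar> - 2 * c) / c \<le> path_metric E p q"
    unfolding path_metric_def
  proof (rule cInf_greatest[OF pl_path_exists[OF G p(1) q(1)]])
    fix l assume "l \<in> {l. pl_path E p q l}"
    then have "\<bar>affine_extension D p - affine_extension D q\<bar> \<le> c * l"
      using pl_path_lipschitz[where D = D and c = c] lip by auto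
    then have "\<bar>D a - D b\<bar> - 2 * c \<le> c * l" using near[OF p] near[OF q] by linarith
    then show "(\<bar>D a - D b\<bar> - 2 * c) / c \<le> l"
      using \<open>0 < c\<close> by (simp add: divide_le_eq mult.commute)
  qed
  then show ?thesis using \<open>0 < c\<close> by (simp add: divide_le_eq algebra_simps)
qed


section \<open>Separation in trees\<close>

definition graph_dist :: "('v \<times> 'v) set \<Rightarrow> 'v \<Rightarrow> 'v \<Rightarrow> nat" where
  "graph_dist E v w = (LEAST n. (v, w) \<in> E ^^ n)"

lemma graph_dist_walk: "(v, w) \<in> E\<^sup>* \<Longrightarrow> (v, w) \<in> E ^^ graph_dist E v w"
  unfolding graph_dist_def by (metis LeastI rtrancl_power)

lemma graph_dist_le: "(v, w) \<in> E ^^ n \<Longrightarrow> graph_dist E v w \<le> n"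
  unfolding graph_dist_def by (rule Least_le)

lemma graph_dist_triangle:
  assumes "(u, v) \<in> E\<^sup>*" "(v, w) \<in> E\<^sup>*"
  shows "graph_dist E u w \<le> graph_dist E u v + graph_dist E v w"
  using graph_dist_walk[OF assms(1)] graph_dist_walk[OF assms(2)]
  by (intro graph_dist_le) (auto simp: relpow_add)

lemma relpow_sym:
  assumes "sym E" "(v, w) \<in> E ^^ n"
  shows "(w, v) \<in> E ^^ n"
  using assms(2)
proof (induction n arbitrary: w)
  case (Suc n)
  then show ?case by (metis assms(1) relpow_Suc_E relpow_Suc_I2 symD)
qed simp

lemma relpow_mono:
  fixes R S :: "('a \<times> 'a) set"
  shows "R \<subseteq> S \<Longrightarrow> R ^^ n \<subseteq> S ^^ n"
  by (induction n) auto

lemma graph_dist_commute: "sym E \<Longrightarrow> graph_dist E v w = graph_dist E w v"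
  unfolding graph_dist_def by (metis relpow_sym)

lemma walk_segment:
  assumes "\<And>i. i < n \<Longrightarrow> (f i, f (Suc i)) \<in> E" "i \<le> j" "j \<le> n"
  shows "(f i, f j) \<in> E ^^ (j - i)"
  using assms(2,3)
proof (induction j rule: dec_induct)
  case (step j)
  then have "(f i, f j) \<in> E ^^ (j - i)" "(f j, f (Suc j)) \<in> E" using assms(1) by auto
  then show ?case using step(1) by (auto simp: Suc_diff_le)
qed simp

text \<open>Along a shortest walk the distance from the start equals the index, since a shorter way
  to \<open>f i\<close> would shorten the whole walk. In particular the vertices of the walk are
  distinct.\<close>

lemma geodesic_walk:
  assumes "(v, w) \<in> E\<^sup>*"
  obtains f where "f 0 = v" "f (graph_dist E v w) = w"
    and "\<And>i. i < graph_dist E v w \<Longrightarrow> (f i, f (Suc i)) \<in> E"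
    and "\<And>i. i \<le> graph_dist E v w \<Longrightarrow> graph_dist E v (f i) = i"
proof -
  define n where "n = graph_dist E v w"
  obtain f where f: "f 0 = v" "f n = w" "\<And>i. i < n \<Longrightarrow> (f i, f (Suc i)) \<in> E"
    using graph_dist_walk[OF assms] unfolding n_def relpow_fun_conv by blast
  have "graph_dist E v (f i) = i" if "i \<le> n" for i
  proof -
    have 1: "(v, f i) \<in> E ^^ i" "(f i, w) \<in> E ^^ (n - i)"
      using walk_segment[of n f E 0 i] walk_segment[of n f E i n] f that by auto
    then have "(v, f i) \<in> E\<^sup>*" by (meson rtrancl_power)
    then have "(v, w) \<in> E ^^ (graph_dist E v (f i) + (n - i))"
      using graph_dist_walk[of v "f i" E] 1(2) by (auto simp: relpow_add)
    then have "n \<le> graph_dist E v (f i) + (n - i)" unfolding n_def by (rule graph_dist_le)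
    then show ?thesis using graph_dist_le[OF 1(1)] that by linarith
  qed
  then show thesis using that f by (simp add: n_def)
qed

text \<open>Only edges are removed: \<open>u\<close> stays as an isolated point, and reachability
  between other vertices means reachability by walks avoiding \<open>u\<close>.\<close>

definition delete_vertex :: "'v \<Rightarrow> ('v \<times> 'v) set \<Rightarrow> ('v \<times> 'v) set" where
  "delete_vertex u E = {(a, b) \<in> E. a \<noteq> u \<and> b \<noteq> u}"

text \<open>A shortest path between two neighbours of \<open>u\<close> that avoids \<open>u\<close> closes up to a cycle.\<close>

lemma acyclic_neighbours_separated:
  assumes acyclic: "\<nexists>vs. graph_cycle E vs" and "sym E"
    and nb: "(l, u) \<in> E" "(u, m) \<in> E" "l \<noteq> m" "l \<noteq> u"
  shows "(l, m) \<notin> (delete_vertex u E)\<^sup>*"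
proof
  let ?R = "delete_vertex u E"
  let ?n = "graph_dist ?R l m"
  assume *: "(l, m) \<in> ?R\<^sup>*"
  obtain f where f: "f 0 = l" "f ?n = m" "\<And>i. i < ?n \<Longrightarrow> (f i, f (Suc i)) \<in> ?R"
    "\<And>i. i \<le> ?n \<Longrightarrow> graph_dist ?R l (f i) = i"
    by (rule geodesic_walk[OF *]) blast
  have "?n \<noteq> 0" using f nb by metis
  \<comment> \<open>The start \<open>l\<close> differs from \<open>u\<close> by assumption; every
    later vertex is the end of an edge that survived the deletion.\<close>
  have "f i \<noteq> u" if "i \<le> ?n" for i
    using f(1) f(3)[of "i - 1"] that nb by (cases i) (auto simp: delete_vertex_def)
  moreover have "inj_on f {..?n}" using f(4) by (intro inj_onI) (metis atMost_iff)
  moreover have "successively (\<lambda>v w. (v, w) \<in> E) (map f [0..<Suc ?n])"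
    using f(3) by (auto simp: successively_conv_nth delete_vertex_def simp del: upt_Suc)
  moreover have "hd (map f [0..<Suc ?n]) = l" "last (map f [0..<Suc ?n]) = m"
    using f(1,2) by (simp_all add: hd_map last_map del: upt_Suc)
  moreover have "{0..<Suc ?n} = {..?n}" by auto
  \<comment> \<open>The list has \<open>?n + 2\<close> entries, so \<open>?n \<noteq> 0\<close>
    gives the required length of at least 3.\<close>
  ultimately have "graph_cycle E (u # map f [0..<Suc ?n])"
    using nb(1,2) \<open>?n \<noteq> 0\<close> symD[OF \<open>sym E\<close>]
    unfolding graph_cycle_def
    by (simp add: distinct_map successively_Cons image_iff del: upt_Suc) blast
  then show False using acyclic by blast
qed

text \<open>The pieces of the path before and after \<open>f i\<close> avoid \<open>f i\<close> by
  injectivity. A walk between the ends avoiding \<open>f i\<close> would therefore connect its two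
  neighbours on the path, against \<open>acyclic_neighbours_separated\<close>.\<close>

lemma tree_geodesic_separates:
  assumes acyclic: "\<nexists>vs. graph_cycle E vs" and "sym E"
    and step: "\<And>i. i < n \<Longrightarrow> (f i, f (Suc i)) \<in> E" and inj: "inj_on f {..n}"
    and i: "0 < i" "i < n"
  shows "(f 0, f n) \<notin> (delete_vertex (f i) E)\<^sup>*"
proof
  let ?R = "delete_vertex (f i) E"
  assume *: "(f 0, f n) \<in> ?R\<^sup>*"
  have neq: "f j \<noteq> f i" if "j \<le> n" "j \<noteq> i" for j
    using inj that i by (auto dest: inj_onD)
  have symR: "sym ?R" using \<open>sym E\<close> by (auto simp: delete_vertex_def sym_def)
  have R: "(f j, f (Suc j)) \<in> ?R" if "j < n" "j \<noteq> i" "Suc j \<noteq> i" for j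
    using step neq that by (auto simp: delete_vertex_def)
  have "(f 0, f (i - 1)) \<in> ?R ^^ (i - 1 - 0)"
    using R i by (intro walk_segment[of "i - 1"]) auto
  then have "(f (i - 1), f 0) \<in> ?R\<^sup>*"
    using symR by (meson rtrancl_power symD sym_rtrancl)
  \<comment> \<open>The second piece is reindexed to start at 0, at the vertex following
    \<open>f i\<close>.\<close>
  moreover have "(f (i + 1 + 0), f (i + 1 + (n - (i + 1)))) \<in> ?R ^^ (n - (i + 1) - 0)"
    using R i by (intro walk_segment[of "n - (i + 1)" "\<lambda>j. f (i + 1 + j)"]) auto
  then have "(f n, f (i + 1)) \<in> ?R\<^sup>*"
    using symR i by (simp) (meson rtrancl_power symD sym_rtrancl)
  ultimately have "(f (i - 1), f (i + 1)) \<in> ?R\<^sup>*" using * by (meson rtrancl_trans)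
  moreover have "(f (i - 1), f i) \<in> E" "(f i, f (i + 1)) \<in> E"
    using step[of "i - 1"] step[of i] i by auto
  moreover have "f (i - 1) \<noteq> f (i + 1)" using inj i by (auto dest: inj_onD)
  ultimately show False
    using acyclic_neighbours_separated[OF acyclic \<open>sym E\<close>] neq[of "i - 1"] i by auto
qed

text \<open>A shortest walk from \<open>v\<close> to \<open>w\<close> only meets vertices at most as
  far from \<open>v\<close> as \<open>w\<close> is, and \<open>u\<close> is farther.\<close>

lemma walk_delete_vertex:
  assumes "(v, w) \<in> E\<^sup>*" and "graph_dist E v w < graph_dist E v u"
  shows "(v, w) \<in> (delete_vertex u E)\<^sup>*"
proof -
  let ?n = "graph_dist E v w"
  obtain f where f: "f 0 = v" "f ?n = w" "\<And>i. i < ?n \<Longrightarrow> (f i, f (Suc i)) \<in> E"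
    "\<And>i. i \<le> ?n \<Longrightarrow> graph_dist E v (f i) = i"
    by (rule geodesic_walk[OF assms(1)]) blast
  have "f i \<noteq> u" if "i \<le> ?n" for i using f(4)[OF that] that assms(2) by auto
  then have "(f i, f (Suc i)) \<in> delete_vertex u E" if "i < ?n" for i
    using f(3) that by (auto simp: delete_vertex_def)
  then have "(f 0, f ?n) \<in> delete_vertex u E ^^ (?n - 0)"
    by (intro walk_segment[of ?n]) auto
  then show ?thesis using f by (auto intro: relpow_imp_rtrancl)
qed

text \<open>If the image of the chain stayed farther than \<open>N\<close> from \<open>f i\<close>,
  a shortest walk replacing each step of the chain would miss \<open>f i\<close>. Concatenated,
  these walks would join the ends of the geodesic in the tree without \<open>f i\<close>, which
  separation forbids.\<close>

lemma coarse_chain_near_geodesic: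
  assumes tree: "simplicial_tree V E" and \<nu>: "\<nu> ` A \<subseteq> V" and H: "H \<subseteq> A \<times> A"
    and step: "\<And>a b. (a, b) \<in> H \<Longrightarrow> graph_dist E (\<nu> a) (\<nu> b) \<le> N"
    and xy: "(x, y) \<in> H\<^sup>*" "x \<in> A" "y \<in> A"
    and f: "f 0 = \<nu> x" "f n = \<nu> y" "\<And>i. i < n \<Longrightarrow> (f i, f (Suc i)) \<in> E" "inj_on f {..n}"
    and i: "0 < i" "i < n"
  shows "\<exists>a\<in>A. graph_dist E (\<nu> a) (f i) \<le> N"
proof (rule ccontr)
  assume "\<not> ?thesis"
  then have far: "graph_dist E (\<nu> a) (f i) > N" if "a \<in> A" for a using that by force
  have conn: "connected_graph V E" "sym E" "\<nexists>vs. graph_cycle E vs"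
    using tree by (auto simp: simplicial_tree_def simplicial_graph_def)
  have "(\<nu> x, \<nu> y) \<in> (delete_vertex (f i) E)\<^sup>*"
    using xy(1)
  proof (induction rule: rtrancl_induct)
    case (step y z)
    then have yz: "y \<in> A" "z \<in> A" using H by auto
    then have "(\<nu> y, \<nu> z) \<in> E\<^sup>*" using conn(1) \<nu> by (auto simp: connected_graph_def)
    then have "(\<nu> y, \<nu> z) \<in> (delete_vertex (f i) E)\<^sup>*"
      using assms(4)[OF step(2)] far[OF yz(1)] by (intro walk_delete_vertex) auto
    then show ?case using step by simp
  qed simp
  then show False
    using tree_geodesic_separates[OF conn(3,2) f(3,4) i] f by simp
qed

text \<open>Replaces a chain of unknown length by one controlled by the geodesic: pick a point of
  \<open>A\<close> near each vertex of the geodesic. Consecutive choices are at most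
  \<open>2 * N + 1\<close> apart: \<open>N\<close> to the geodesic, one edge along it, and
  \<open>N\<close> back.\<close>

lemma coarse_chain_shortcut:
  assumes tree: "simplicial_tree V E" and \<nu>: "\<nu> ` A \<subseteq> V" and H: "H \<subseteq> A \<times> A"
    and step: "\<And>a b. (a, b) \<in> H \<Longrightarrow> graph_dist E (\<nu> a) (\<nu> b) \<le> N"
    and xy: "(x, y) \<in> H\<^sup>*" "x \<in> A" "y \<in> A"
  shows "(x, y) \<in> {(a, b). a \<in> A \<and> b \<in> A \<and> graph_dist E (\<nu> a) (\<nu> b) \<le> 2 * N + 1}
           ^^ Suc (graph_dist E (\<nu> x) (\<nu> y))"
proof -
  have conn: "connected_graph V E" "sym E" "E \<subseteq> V \<times> V"
    using tree by (auto simp: simplicial_tree_def simplicial_graph_def)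
  have reach: "(u, w) \<in> E\<^sup>*" if "u \<in> V" "w \<in> V" for u w
    using conn(1) that by (simp add: connected_graph_def)
  let ?n = "graph_dist E (\<nu> x) (\<nu> y)"
  have *: "(\<nu> x, \<nu> y) \<in> E\<^sup>*" using reach \<nu> xy by auto
  obtain f where f: "f 0 = \<nu> x" "f ?n = \<nu> y" "\<And>i. i < ?n \<Longrightarrow> (f i, f (Suc i)) \<in> E"
    "\<And>i. i \<le> ?n \<Longrightarrow> graph_dist E (\<nu> x) (f i) = i"
    by (rule geodesic_walk[OF *]) blast
  have inj: "inj_on f {..?n}" using f(4) by (intro inj_onI) (metis atMost_iff)
  have refl: "graph_dist E u u = 0" for u using graph_dist_le[of u u 0 E] by simp
  have fV: "f i \<in> V" if "i \<le> ?n" for i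
    using f(1) f(3)[of "i - 1"] that conn(3) \<nu> xy by (cases i) auto
  \<comment> \<open>Only the start of the new chain is pinned. The end \<open>y\<close> is appended
    as an additional step, whence \<open>Suc\<close>; it also covers distinct \<open>x\<close> and
    \<open>y\<close> with the same image vertex.\<close>
  have "\<exists>a. a \<in> A \<and> graph_dist E (\<nu> a) (f i) \<le> N \<and> (i = 0 \<longrightarrow> a = x)" if "i \<le> ?n" for i
  proof -
    consider "i = 0" | "0 < i" "i = ?n" | "0 < i" "i < ?n"
      using \<open>i \<le> ?n\<close> by linarith
    then show ?thesis
    proof cases
      case 3
      then show ?thesis
        using coarse_chain_near_geodesic[OF tree \<nu> H step xy f(1,2,3) inj 3] by auto
    qed (use f(1,2) refl xy in auto)
  qed
  then have "\<exists>a. \<forall>i\<le>?n. a i \<in> A \<and> graph_dist E (\<nu> (a i)) (f i) \<le> N \<and> (i = 0 \<longrightarrow> a i = x)"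
    by metis
  then obtain a where a: "\<And>i. i \<le> ?n \<Longrightarrow> a i \<in> A"
    "\<And>i. i \<le> ?n \<Longrightarrow> graph_dist E (\<nu> (a i)) (f i) \<le> N" "a 0 = x" by blast
  have "graph_dist E (\<nu> (a i)) (\<nu> (a (Suc i))) \<le> 2 * N + 1" if "i < ?n" for i
  proof -
    have V: "\<nu> (a i) \<in> V" "f i \<in> V" "f (Suc i) \<in> V" "\<nu> (a (Suc i)) \<in> V"
      using a(1)[of i] a(1)[of "Suc i"] \<nu> fV[of i] fV[of "Suc i"] that by auto
    have "graph_dist E (\<nu> (a i)) (\<nu> (a (Suc i))) \<le> graph_dist E (\<nu> (a i)) (f i)
        + (graph_dist E (f i) (f (Suc i)) + graph_dist E (f (Suc i)) (\<nu> (a (Suc i))))"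
      using graph_dist_triangle[OF reach reach] V by (meson add_left_mono order_trans)
    moreover have "graph_dist E (f i) (f (Suc i)) \<le> 1"
      using f(3)[OF that] by (intro graph_dist_le) auto
    moreover have "graph_dist E (f (Suc i)) (\<nu> (a (Suc i))) \<le> N"
      using a(2)[of "Suc i"] graph_dist_commute[OF conn(2)] that by (metis Suc_leI)
    moreover have "graph_dist E (\<nu> (a i)) (f i) \<le> N" using a(2)[of i] that by simp
    ultimately show ?thesis by linarith
  qed
  moreover have "graph_dist E (\<nu> (a ?n)) (\<nu> y) \<le> 2 * N + 1"
    using a(2)[of ?n] f(2) by simp
  ultimately show ?thesis
    unfolding relpow_fun_conv using a(1,3) xy
    by (intro exI[of _ "\<lambda>i. if i \<le> ?n then a i else y"]) (auto simp: not_le less_Suc_eq)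
qed


section \<open>Rips graphs of orbits\<close>

text \<open>Induction over words in the generators. The action carries chains to chains with the
  same step bound, so a chain to \<open>\<phi> h1 x0\<close> continues by the
  \<open>h1\<close>-translate of a chain to \<open>\<phi> h2 x0\<close>.\<close>

lemma orbit_coarsely_connected:
  assumes fg: "finitely_generated G" and act: "isometric_action G Q d \<phi>" and x0: "x0 \<in> Q"
  obtains R where "\<And>x y. x \<in> orbit G \<phi> x0 \<Longrightarrow> y \<in> orbit G \<phi> x0 \<Longrightarrow>
    (x, y) \<in> {(a, b). a \<in> orbit G \<phi> x0 \<and> b \<in> orbit G \<phi> x0 \<and> d a b \<le> R}\<^sup>*"
proof -
  interpret action: group_action G Q \<phi> using act by (simp add: isometric_action_def)
  interpret Metric_space Q d using act by (simp add: isometric_action_def)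
  interpret group G using action.group_hom group_hom.axioms(1) by blast
  have iso: "d (\<phi> g x) (\<phi> g y) = d x y" if "g \<in> carrier G" "x \<in> Q" "y \<in> Q" for g x y
    using act that by (simp add: isometric_action_def)
  obtain S where S: "finite S" "S \<subseteq> carrier G" "generate G S = carrier G"
    using fg by (auto simp: finitely_generated_def)
  \<comment> \<open>The largest displacement of \<open>x0\<close> by a generator; inserting 0 keeps
    \<open>Max\<close> meaningful for empty \<open>S\<close>.\<close>
  define R where "R = Max (insert 0 ((\<lambda>s. d x0 (\<phi> s x0)) ` S))"
  have R: "d x0 (\<phi> s x0) \<le> R" if "s \<in> S" for s
    unfolding R_def using S(1) that by (intro Max_ge) auto
  define H where "H = {(a, b). a \<in> orbit G \<phi> x0 \<and> b \<in> orbit G \<phi> x0 \<and> d a b \<le> R}"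
  have orb: "\<phi> g x0 \<in> orbit G \<phi> x0" if "g \<in> carrier G" for g
    using that by (auto simp: orbit_def)
  have orbQ: "x \<in> Q" if "x \<in> orbit G \<phi> x0" for x
    using that x0 action.element_image by (auto simp: orbit_def)
  have x0_orb: "x0 \<in> orbit G \<phi> x0" by (rule action.orbit_refl[OF x0])
  have orb_image: "\<phi> g x \<in> orbit G \<phi> x0" if "g \<in> carrier G" "x \<in> orbit G \<phi> x0" for g x
    using that x0 action.composition_rule by (auto simp: orbit_def) (metis m_closed)
  have H_image: "(\<phi> g x, \<phi> g y) \<in> H\<^sup>*" if "(x, y) \<in> H\<^sup>*" "g \<in> carrier G" for g x y
    using that(1)
  proof induction
    case (step y z)
    then have "(\<phi> g y, \<phi> g z) \<in> H"
      using that(2) orb_image orbQ iso by (auto simp: H_def)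
    then show ?case using step by simp
  qed simp
  have gen: "g \<in> carrier G \<and> (x0, \<phi> g x0) \<in> H\<^sup>*" if "g \<in> generate G S" for g
    using that
  proof induction
    case one
    then show ?case using action.id_eq_one x0 by (metis one_closed restrict_apply' rtrancl.rtrancl_refl)
  next
    case (incl h)
    then show ?case using S(2) R orb x0_orb by (auto simp: H_def)
  next
    case (inv h)
    then have h: "h \<in> carrier G" "inv\<^bsub>G\<^esub> h \<in> carrier G" using S(2) by auto
    then have "\<phi> h (\<phi> (inv\<^bsub>G\<^esub> h) x0) = x0"
      using action.orbit_sym_aux[OF h(2) x0 refl] by simp
    \<comment> \<open>An inverse moves \<open>x0\<close> exactly as far as the generator
      does.\<close>
    then have "d x0 (\<phi> (inv\<^bsub>G\<^esub> h) x0) = d (\<phi> h x0) x0"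
      using iso[OF h(1) x0 orbQ[OF orb[OF h(2)]]] by simp
    then show ?case using R[OF inv] h orb x0_orb by (auto simp: H_def commute)
  next
    case (eng h1 h2)
    then show ?case
      using H_image[of x0 "\<phi> h2 x0" h1] action.composition_rule[OF x0] by (auto intro: rtrancl_trans)
  qed
  have "sym H" by (auto simp: H_def sym_def commute)
  then have "sym (H\<^sup>*)" by (rule sym_rtrancl)
  moreover have "(x0, x) \<in> H\<^sup>*" if "x \<in> orbit G \<phi> x0" for x
    using that gen S(3) by (auto simp: orbit_def)
  ultimately have "(x, y) \<in> H\<^sup>*" if "x \<in> orbit G \<phi> x0" "y \<in> orbit G \<phi> x0" for x y
    using that by (meson rtrancl_trans symD)
  then show thesis using that unfolding H_def by blast
qed

text \<open>Transfers the shortcut in the tree back to \<open>Q\<close>. One \<open>r\<close> serves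
  all pairs, and the affine bound on the number of steps yields both connectedness and the lower
  bound of the embedding.\<close>

lemma rips_walk_quasitree:
  assumes fg: "finitely_generated G" and act: "isometric_action G Q d \<phi>" and x0: "x0 \<in> Q"
    and qt: "quasitree TYPE('v) Q d"
  obtains r K C n where "r > 0" "K \<ge> 1" "C \<ge> 0"
    and "\<And>x y. x \<in> orbit G \<phi> x0 \<Longrightarrow> y \<in> orbit G \<phi> x0 \<Longrightarrow>
      (x, y) \<in> ((rips_edges G d \<phi> r x0)\<^sup>=) ^^ n x y \<and> real (n x y) \<le> K * d x y + C"
proof -
  interpret action: group_action G Q \<phi> using act by (simp add: isometric_action_def)
  interpret Metric_space Q d using act by (simp add: isometric_action_def)
  let ?A = "orbit G \<phi> x0"
  have orbQ: "x \<in> Q" if "x \<in> ?A" for x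
    using that x0 action.element_image by (auto simp: orbit_def)
  obtain R where R: "(x, y) \<in> {(a, b). a \<in> ?A \<and> b \<in> ?A \<and> d a b \<le> R}\<^sup>*"
    if "x \<in> ?A" "y \<in> ?A" for x y
    by (rule orbit_coarsely_connected[OF fg act x0]) (rule that)
  obtain V :: "'v set" and E f where tree: "simplicial_tree V E"
    and f: "qi_embedding Q d (realization V E) (path_metric E) f"
    using qt by (auto simp: quasitree_def quasi_isometry_def)
  have G: "simplicial_graph V E" "connected_graph V E" using tree by (auto simp: simplicial_tree_def)
  obtain K C where K: "K \<ge> 1" "C \<ge> 0"
    and lower: "\<And>x y. x \<in> Q \<Longrightarrow> y \<in> Q \<Longrightarrow> d x y / K - C \<le> path_metric E (f x) (f y)"
    and upper: "\<And>x y. x \<in> Q \<Longrightarrow> y \<in> Q \<Longrightarrow> path_metric E (f x) (f y) \<le> K * d x y + C"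
    using f unfolding qi_embedding_def by blast
  have fQ: "f x \<in> realization V E" if "x \<in> Q" for x using f that by (auto simp: qi_embedding_def)
  \<comment> \<open>Rounds \<open>f x\<close> to a vertex of its support, at path distance at most
    one.\<close>
  define \<nu> where "\<nu> x = (SOME v. f x v \<noteq> 0)" for x
  have \<nu>: "f x (\<nu> x) \<noteq> 0" if "x \<in> Q" for x
    unfolding \<nu>_def using realization_support[OF fQ[OF that]] by (rule someI_ex)
  have \<nu>V: "\<nu> x \<in> V" if "x \<in> Q" for x
    using realization_cell(1)[OF G(1) fQ[OF that] \<nu>[OF that]] .
  have reach: "(u, w) \<in> E\<^sup>*" if "u \<in> V" "w \<in> V" for u w
    using G(2) that by (simp add: connected_graph_def)
  have dist_upper: "real (graph_dist E (\<nu> x) (\<nu> y)) \<le> K * d x y + C + 2"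
    if "x \<in> Q" "y \<in> Q" for x y
  proof -
    let ?D = "\<lambda>w. real (graph_dist E (\<nu> x) w)"
    have "\<bar>?D u - ?D w\<bar> \<le> 1" if "(u, w) \<in> E" for u w
    proof -
      have uw: "u \<in> V" "w \<in> V" "(w, u) \<in> E"
        using G(1) that by (auto simp: simplicial_graph_def dest: symD)
      have "graph_dist E u w \<le> 1" "graph_dist E w u \<le> 1"
        using that uw by (auto intro!: graph_dist_le)
      then have "graph_dist E (\<nu> x) w \<le> graph_dist E (\<nu> x) u + 1"
        "graph_dist E (\<nu> x) u \<le> graph_dist E (\<nu> x) w + 1"
        using graph_dist_triangle[OF reach[OF \<nu>V[OF \<open>x \<in> Q\<close>] uw(1)] reach[OF uw(1,2)]]
          graph_dist_triangle[OF reach[OF \<nu>V[OF \<open>x \<in> Q\<close>] uw(2)] reach[OF uw(2,1)]]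
        by linarith+
      then show ?thesis by (simp add: abs_le_iff)
    qed
    from lipschitz_le_path_metric[where D = ?D and c = 1, OF G fQ[OF that(1)] \<nu>[OF that(1)]
        fQ[OF that(2)] \<nu>[OF that(2)] this]
    have "\<bar>?D (\<nu> x) - ?D (\<nu> y)\<bar> \<le> path_metric E (f x) (f y) + 2" by simp
    moreover have "graph_dist E (\<nu> x) (\<nu> x) = 0"
      using graph_dist_le[of "\<nu> x" "\<nu> x" 0 E] by simp
    ultimately show ?thesis using upper[OF that] by simp
  qed
  \<comment> \<open>Bounds the tree distance between the images of orbit points at distance at most
    \<open>R\<close>.\<close>
  define N where "N = nat \<lceil>K * R + C + 2\<rceil>"
  \<comment> \<open>Inverts the lower bound \<open>d a b / K - C\<close> at tree distance
    \<open>2 * N + 1\<close>, with 2 added for undoing the rounding at both ends.\<close>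
  define r where "r = K * (real (2 * N + 1) + 2 + C)"
  let ?H = "{(a, b). a \<in> ?A \<and> b \<in> ?A \<and> d a b \<le> R}"
  let ?J = "{(a, b). a \<in> ?A \<and> b \<in> ?A \<and> graph_dist E (\<nu> a) (\<nu> b) \<le> 2 * N + 1}"
  have "graph_dist E (\<nu> a) (\<nu> b) \<le> N" if "(a, b) \<in> ?H" for a b
  proof -
    have "K * d a b \<le> K * R" using that K by (intro mult_left_mono) auto
    then have "real (graph_dist E (\<nu> a) (\<nu> b)) \<le> K * R + C + 2"
      using dist_upper[of a b] that orbQ by auto
    then show ?thesis unfolding N_def by linarith
  qed
  then have walk: "(x, y) \<in> ?J ^^ Suc (graph_dist E (\<nu> x) (\<nu> y))" if "x \<in> ?A" "y \<in> ?A" for x y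
    using coarse_chain_shortcut[OF tree, of \<nu> ?A ?H N x y] \<nu>V orbQ R that by blast
  have "?J \<subseteq> (rips_edges G d \<phi> r x0)\<^sup>="
  proof clarify
    fix a b assume ab: "a \<in> ?A" "b \<in> ?A" "graph_dist E (\<nu> a) (\<nu> b) \<le> 2 * N + 1"
      and ne: "(a, b) \<notin> rips_edges G d \<phi> r x0"
    have Q: "a \<in> Q" "b \<in> Q" using ab orbQ by auto
    have "(\<nu> a, \<nu> b) \<in> (E\<^sup>=) ^^ graph_dist E (\<nu> a) (\<nu> b)"
      using relpow_mono[of E "E\<^sup>="] graph_dist_walk[OF reach[OF \<nu>V[OF Q(1)] \<nu>V[OF Q(2)]]] by blast
    then have "path_metric E (f a) (f b) \<le> real (2 * N + 1) + 2"
      using path_metric_le_walk[OF G(1) fQ[OF Q(1)] fQ[OF Q(2)] \<nu>[OF Q(1)] \<nu>[OF Q(2)]] ab(3)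
      by fastforce
    then have "d a b / K \<le> real (2 * N + 1) + 2 + C" using lower[OF Q] by linarith
    then have "d a b \<le> r" using K by (simp add: r_def divide_le_eq mult.commute)
    then show "a = b" using ne ab by (auto simp: rips_edges_def)
  qed
  then have "(x, y) \<in> ((rips_edges G d \<phi> r x0)\<^sup>=) ^^ Suc (graph_dist E (\<nu> x) (\<nu> y))"
    if "x \<in> ?A" "y \<in> ?A" for x y
    using walk[OF that] relpow_mono by blast
  \<comment> \<open>The constant is \<open>C + 2\<close> from \<open>dist_upper\<close> plus one for
    the appended step.\<close>
  moreover have "real (Suc (graph_dist E (\<nu> x) (\<nu> y))) \<le> K * d x y + (C + 3)"
    if "x \<in> ?A" "y \<in> ?A" for x y
    using dist_upper[of x y] that orbQ by simp
  moreover have "r > 0" unfolding r_def using K by (intro mult_pos_pos) auto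
  ultimately show thesis using that[of r K "C + 3" "\<lambda>x y. Suc (graph_dist E (\<nu> x) (\<nu> y))"] K by simp
qed

text \<open>Coordinates are nonnegative, so those of vertices with a common image cannot cancel; the
  cell makes the sum finite.\<close>

lemma simplicial_map_support:
  assumes "p \<in> cell a b"
  shows "simplicial_map f p w \<noteq> 0 \<longleftrightarrow> (\<exists>v. p v \<noteq> 0 \<and> f v = w)"
proof
  assume "simplicial_map f p w \<noteq> 0"
  then obtain v where "v \<in> {v. p v \<noteq> 0 \<and> f v = w}"
    unfolding simplicial_map_def by (rule sum.not_neutral_contains_not_neutral)
  then show "\<exists>v. p v \<noteq> 0 \<and> f v = w" by blast
next
  assume "\<exists>v. p v \<noteq> 0 \<and> f v = w"
  then obtain v where v: "p v \<noteq> 0" "f v = w" by blast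
  have p: "0 \<le> p u" for u using assms by (simp add: cell_def)
  have "{v. p v \<noteq> 0 \<and> f v = w} \<subseteq> {a, b}" using assms by (auto simp: cell_def)
  then have "finite {v. p v \<noteq> 0 \<and> f v = w}" by (rule finite_subset) simp
  then have "p v \<le> (\<Sum>v | p v \<noteq> 0 \<and> f v = w. p v)"
    using v p by (intro member_le_sum) simp_all
  then have "p v \<le> simplicial_map f p w" by (simp only: simplicial_map_def)
  moreover have "0 < p v" using v p[of v] by simp
  ultimately show "simplicial_map f p w \<noteq> 0" by simp
qed

text \<open>Neighbours of \<open>\<phi> g x0\<close> are \<open>g\<close>-translates of orbit points
  within \<open>r\<close> of \<open>x0\<close>. The number of these is finite and independent of
  \<open>g\<close>.\<close>

lemma rips_bounded_valence:
  assumes act: "isometric_action G Q d \<phi>" and x0: "x0 \<in> Q" and "r > 0"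
    and lf: "locally_finite_orbit G d \<phi> x0"
  shows "bounded_valence (orbit G \<phi> x0) (rips_edges G d \<phi> r x0)"
proof -
  interpret action: group_action G Q \<phi> using act by (simp add: isometric_action_def)
  interpret Metric_space Q d using act by (simp add: isometric_action_def)
  interpret group G using action.group_hom group_hom.axioms(1) by blast
  let ?B = "{\<phi> g x0 | g. g \<in> carrier G \<and> d (\<phi> g x0) x0 \<le> r}"
  have B: "finite ?B" using lf \<open>r > 0\<close> by (auto simp: locally_finite_orbit_def)
  have "finite {w. (v, w) \<in> rips_edges G d \<phi> r x0} \<and>
      card {w. (v, w) \<in> rips_edges G d \<phi> r x0} \<le> card ?B" if "v \<in> orbit G \<phi> x0" for v
  proof -
    obtain g where g: "g \<in> carrier G" "v = \<phi> g x0"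
      using \<open>v \<in> orbit G \<phi> x0\<close> by (auto simp: orbit_def)
    have "{w. (v, w) \<in> rips_edges G d \<phi> r x0} \<subseteq> \<phi> g ` ?B"
    proof clarify
      fix w assume w: "(v, w) \<in> rips_edges G d \<phi> r x0"
      then obtain h where h: "h \<in> carrier G" "w = \<phi> h x0"
        by (auto simp: orbit_def rips_edges_def)
      let ?k = "inv\<^bsub>G\<^esub> g \<otimes>\<^bsub>G\<^esub> h"
      have k: "?k \<in> carrier G" using g h by simp
      have "g \<otimes>\<^bsub>G\<^esub> ?k = h" using g h by (simp add: m_assoc[symmetric])
      then have w_eq: "\<phi> g (\<phi> ?k x0) = w"
        using h(2) action.composition_rule[OF x0 g(1) k] by simp
      have "\<phi> ?k x0 \<in> Q" using action.element_image[OF k x0 refl] .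
      then have "d (\<phi> ?k x0) x0 = d w v"
        using act g x0 unfolding w_eq[symmetric] by (simp add: isometric_action_def)
      then have "d (\<phi> ?k x0) x0 \<le> r" using w by (simp add: rips_edges_def commute)
      then have "\<phi> ?k x0 \<in> ?B" using k by blast
      then show "w \<in> \<phi> g ` ?B" by (rule rev_image_eqI) (simp add: w_eq)
    qed
    then have "finite {w. (v, w) \<in> rips_edges G d \<phi> r x0}"
      "card {w. (v, w) \<in> rips_edges G d \<phi> r x0} \<le> card (\<phi> g ` ?B)"
      using B by (auto intro: finite_subset card_mono)
    then show ?thesis using card_image_le[OF B, of "\<phi> g"] by linarith
  qed
  then show ?thesis unfolding bounded_valence_def by blast
qed

section \<open>Choosing an endpoint: quasi-isometric embedding and coarse equivariance\<close>

theorem corollary5p3: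
  fixes G :: "('g, 'm) monoid_scheme"
    and Q :: "'q set"
    and d :: "'q \<Rightarrow> 'q \<Rightarrow> real"
    and \<phi> :: "'g \<Rightarrow> 'q \<Rightarrow> 'q"
    and x0 :: 'q
  assumes "group G"
    and "finitely_generated G"
    and "quasitree TYPE('v) Q d"
    and "isometric_action G Q d \<phi>"
    and "x0 \<in> Q"
  shows "\<exists>r>0.
    connected_graph (orbit G \<phi> x0) (rips_edges G d \<phi> r x0) \<and>
    (\<exists>F. qi_embedding
            (realization (orbit G \<phi> x0) (rips_edges G d \<phi> r x0))
            (path_metric (rips_edges G d \<phi> r x0)) Q d F \<and>
         coarse_equivariant G
            (realization (orbit G \<phi> x0) (rips_edges G d \<phi> r x0))
            (\<lambda>g. simplicial_map (\<phi> g)) d \<phi> F) \<and>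
    (locally_finite_orbit G d \<phi> x0 \<longrightarrow>
      bounded_valence (orbit G \<phi> x0) (rips_edges G d \<phi> r x0))"
proof -
  interpret action: group_action G Q \<phi> using assms(4) by (simp add: isometric_action_def)
  interpret Metric_space Q d using assms(4) by (simp add: isometric_action_def)
  obtain r K C n where r: "r > 0" and K: "K \<ge> 1" "C \<ge> 0"
    and walk: "\<And>x y. x \<in> orbit G \<phi> x0 \<Longrightarrow> y \<in> orbit G \<phi> x0 \<Longrightarrow>
      (x, y) \<in> ((rips_edges G d \<phi> r x0)\<^sup>=) ^^ n x y \<and> real (n x y) \<le> K * d x y + C"
    by (rule rips_walk_quasitree[OF assms(2,4,5,3)]) (rule that)
  let ?A = "orbit G \<phi> x0" and ?E = "rips_edges G d \<phi> r x0"
  let ?X = "realization ?A ?E"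
  have AQ: "x \<in> Q" if "x \<in> ?A" for x
    using that assms(5) action.element_image by (auto simp: orbit_def)
  have sg: "simplicial_graph ?A ?E"
    by (auto simp: simplicial_graph_def rips_edges_def sym_def irrefl_def commute)
  have cg: "connected_graph ?A ?E"
    unfolding connected_graph_def
  proof (intro ballI)
    fix v w assume "v \<in> ?A" "w \<in> ?A"
    then have "(v, w) \<in> (?E\<^sup>=)\<^sup>*" using walk relpow_imp_rtrancl by blast
    then show "(v, w) \<in> ?E\<^sup>*" by simp
  qed
  \<comment> \<open>Any vertex of the support will do. The choices need not be compatible with the
    action, so \<open>F\<close> is equivariant only up to an error.\<close>
  define F where "F p = (SOME a. p a \<noteq> 0)" for p :: "'q \<Rightarrow> real"
  have F: "p (F p) \<noteq> 0" if "\<exists>a. p a \<noteq> 0" for p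
    unfolding F_def using that by (rule someI_ex)
  have FX: "p (F p) \<noteq> 0" "F p \<in> ?A" if "p \<in> ?X" for p
    using realization_cell(1)[OF sg that] F realization_support[OF that] by auto
  have "qi_embedding ?X (path_metric ?E) Q d F"
    unfolding qi_embedding_def
  proof (intro conjI)
    show "F ` ?X \<subseteq> Q" using FX AQ by auto
    \<comment> \<open>\<open>r\<close> serves the upper bound, since a Rips edge has length at most
      \<open>r\<close> in \<open>Q\<close>, and \<open>K\<close> the lower one. In \<open>M\<close>,
      \<open>2 * r\<close> pays for the two ends in the upper bound and \<open>C + 2\<close> for the
      additive error in the lower bound.\<close>
    define L where "L = max r K"
    define M where "M = 2 * r + C + 2"
    have "path_metric ?E p q / L - M \<le> d (F p) (F q) \<and> d (F p) (F q) \<le> L * path_metric ?E p q + M"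
      if pq: "p \<in> ?X" "q \<in> ?X" for p q
    proof
      have A: "F p \<in> ?A" "F q \<in> ?A" using FX pq by auto
      have pm: "path_metric ?E p q \<le> K * d (F p) (F q) + C + 2"
        using path_metric_le_walk[OF sg pq FX(1)[OF pq(1)] FX(1)[OF pq(2)]] walk[OF A] by fastforce
      have L: "L \<ge> 1" "K \<le> L" "r \<le> L" using K by (auto simp: L_def)
      have "K * d (F p) (F q) \<le> L * d (F p) (F q)" using L by (intro mult_right_mono) auto
      moreover have "C + 2 \<le> L * M"
        using mult_mono[of 1 L "C + 2" M] L K r by (simp add: M_def)
      ultimately have "path_metric ?E p q \<le> L * (d (F p) (F q) + M)"
        using pm by (simp add: distrib_left)
      then show "path_metric ?E p q / L - M \<le> d (F p) (F q)"
        using L by (simp add: divide_le_eq mult.commute diff_le_eq)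
      \<comment> \<open>By the triangle inequality, \<open>d (F p)\<close> is a vertex function to
        which the Lipschitz bound applies with constant \<open>r\<close>.\<close>
      have "\<bar>d (F p) u - d (F p) w\<bar> \<le> r" if "(u, w) \<in> ?E" for u w
      proof -
        have uw: "u \<in> Q" "w \<in> Q" "d u w \<le> r" using that AQ by (auto simp: rips_edges_def)
        then show ?thesis
          using triangle[OF AQ[OF A(1)] uw(1,2)] triangle[OF AQ[OF A(1)] uw(2,1)] commute[of u w]
          by linarith
      qed
      from lipschitz_le_path_metric[where D = "d (F p)", OF sg cg pq(1) FX(1)[OF pq(1)]
          pq(2) FX(1)[OF pq(2)] this r]
      have *: "d (F p) (F q) \<le> r * (path_metric ?E p q + 2)"
        using AQ A by (simp add: abs_le_iff)
      have "r * path_metric ?E p q \<le> L * path_metric ?E p q"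
        using L(3) path_metric_nonneg[OF sg cg pq] by (intro mult_right_mono)
      then show "d (F p) (F q) \<le> L * path_metric ?E p q + M"
        using * K by (simp add: M_def distrib_left)
    qed
    moreover have "L \<ge> 1" "M \<ge> 0" using K r by (auto simp: L_def M_def)
    ultimately show "\<exists>K\<ge>1. \<exists>C\<ge>0. \<forall>p\<in>?X. \<forall>q\<in>?X.
        path_metric ?E p q / K - C \<le> d (F p) (F q) \<and> d (F p) (F q) \<le> K * path_metric ?E p q + C"
      by (intro exI[of _ L] exI[of _ M] conjI ballI) simp_all
  qed
  moreover have "coarse_equivariant G ?X (\<lambda>g. simplicial_map (\<phi> g)) d \<phi> F"
    unfolding coarse_equivariant_def
  proof (intro exI[of _ r] conjI ballI)
    fix p g assume p: "p \<in> ?X" and g: "g \<in> carrier G"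
    obtain b where b: "p \<in> cell (F p) b" "b = F p \<or> (F p, b) \<in> ?E"
      using realization_cell(2)[OF sg p FX(1)[OF p]] by blast
    have supp: "simplicial_map (\<phi> g) p w \<noteq> 0 \<longleftrightarrow> (\<exists>v. p v \<noteq> 0 \<and> \<phi> g v = w)" for w
      by (rule simplicial_map_support[OF b(1)])
    have "simplicial_map (\<phi> g) p (\<phi> g (F p)) \<noteq> 0" unfolding supp using FX(1)[OF p] by blast
    \<comment> \<open>The endpoint chosen for the image of \<open>p\<close> is the translate of some
      vertex \<open>v\<close> in the support of \<open>p\<close>, possibly other than
      \<open>F p\<close>.\<close>
    then have "simplicial_map (\<phi> g) p (F (simplicial_map (\<phi> g) p)) \<noteq> 0" by (intro F exI)
    then obtain v where v: "p v \<noteq> 0" "\<phi> g v = F (simplicial_map (\<phi> g) p)"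
      unfolding supp by blast
    have vA: "v \<in> ?A" using realization_cell(1)[OF sg p v(1)] .
    \<comment> \<open>Both vertices lie in one cell, so they coincide or span a Rips edge; hence the
      error is at most \<open>r\<close>.\<close>
    have "v = F p \<or> (v = b \<and> (F p, b) \<in> ?E)" using b v(1) by (auto simp: cell_def)
    then have "d v (F p) \<le> r"
    proof (elim disjE conjE)
      assume "v = F p"
      then show ?thesis using r AQ[OF vA] by simp
    next
      assume "v = b" "(F p, b) \<in> ?E"
      then show ?thesis by (simp add: rips_edges_def commute)
    qed
    then show "d (F (simplicial_map (\<phi> g) p)) (\<phi> g (F p)) \<le> r"
      using assms(4) g AQ[OF vA] AQ[OF FX(2)[OF p]]
      unfolding v(2)[symmetric] by (simp add: isometric_action_def)
  qed (use r in simp)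
  ultimately show ?thesis
    using r cg rips_bounded_valence[OF assms(4,5) r] by (intro exI[of _ r] conjI exI[of _ F]) auto
qed

end
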